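(* Let $D$ be a fixed (time-independent) object with $f=0$, and let $c>0$. Let $(p,q,\bm{\chi},\bm{\lambda})$, with $p,q$ scalar and $\bm\chi,\bm\lambda$ $\mathbb{R}^2$-valued, be a sufficiently smooth solution on $(\Omega\setminus\overline{D})\times(0,T]$ of the first-order system $$p_t=q-ap,\qquad q_t=-bp+c\nabla\cdot\bm{\chi},\qquad \bm{\chi}_t=c\nabla q-2\varGamma_1\bm{\chi}+\varGamma_1\bm{\lambda},\qquad \bm{\lambda}_t=-\widetilde{\varGamma}_1\bm{\lambda}+\varGamma_2\bm{\chi},$$ with boundary conditions $p=0$ on $\partial D$, and $p=0$, $\bm{\lambda}\cdot\mathbf{n}=0$ on $\partial\Omega$. Then the energy $$\mathcal{E}=\tfrac12\Big(\|q\|^2+\|\bm{\chi}\|^2+\|p\|_b^2+\|\bm{\lambda}\|_{a^{-1}\varGamma_1}^2\Big)$$ satisfies $$\frac{d\mathcal{E}}{dt}=-\mathcal{D}(t),\qquad \mathcal{D}(t)=\|p\|_{ab}^2+\|\bm{\chi}\|_{\varGamma_1+a^{-1}\varGamma_1^2}^2+\|\bm{\chi}-\bm{\lambda}\|_{a^{-1}b}^2\ge 0.$$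
   Context: $\Omega_{\rm phy}=(-a_1,a_1)\times(-a_2,a_2)$ and $\Omega=(-a_1-L_1,a_1+L_1)\times(-a_2-L_2,a_2+L_2)$ with $a_i,L_i>0$; $\mathbf n$ is the unit normal on $\partial\Omega$. The object $D$ is a smooth bounded open set with $\overline D\subset\Omega_{\rm phy}$. The damping profiles are $\xi_i=\xi_i(x_i)\ge 0$, $i=1,2$, with $\xi_i(x_i)=0$ for $|x_i|<a_i$ and $\xi_i(x_i)=\overline{\xi}_i\Big(\frac{|x_i|-a_i}{L_i}-\frac{1}{2\pi}\sin\frac{2\pi(|x_i|-a_i)}{L_i}\Big)$ for $a_i\le|x_i|\le a_i+L_i$, where $\overline\xi_i\ge0$ is a parameter. Set $$\varGamma_1=\mathrm{diag}(\xi_1,\xi_2),\quad \varGamma_2=\mathrm{diag}(\xi_2-\xi_1,\ \xi_1-\xi_2),\quad \widetilde{\varGamma}_1=\varGamma_1+\varGamma_2,\quad a=\mathrm{tr}(\varGamma_1)=\xi_1+\xi_2,\quad b=\det(\varGamma_1)=\xi_1\xi_2.$$ $(\cdot,\cdot)$ and $\|\cdot\|$ are the $L^2(\Omega\setminus\overline{D})$ inner product and norm (scalar or vector valued), and $\|u\|_\omega^2=(\omega u,u)$ for a nonnegative function or symmetric positive semidefinite matrix field $\omega$. Where $a=0$, the (bounded) quantities $a^{-1}\varGamma_1$, $a^{-1}\varGamma_1^2$ and $a^{-1}b$ are understood to be $0$. *)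

theory Defs
  imports "HOL-Analysis.Analysis"
begin

definition smooth_real_fun :: "(real \<Rightarrow> real) \<Rightarrow> bool" where
  "smooth_real_fun \<gamma> \<longleftrightarrow> (\<forall>k. (deriv ^^ k) \<gamma> differentiable_on UNIV)"

text \<open>Near each boundary point and in suitable orthonormal coordinates, the set is the strict
  epigraph of a \<open>C\<^sup>\<infinity>\<close> function. In particular it lies locally on one side of its boundary.\<close>

definition smooth_open_set :: "(real^2) set \<Rightarrow> bool" where
  "smooth_open_set D \<longleftrightarrow> open D \<and>
     (\<forall>x0 \<in> frontier D. \<exists>r>0. \<exists>(R :: real^2 \<Rightarrow> real^2) \<gamma>. orthogonal_transformation R \<and> smooth_real_fun \<gamma> \<and>
        D \<inter> ball x0 r = {x \<in> ball x0 r. \<gamma> (R x $ 1) < R x $ 2})"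

text \<open>\<open>n\<close> is the outward unit normal at \<open>x\<close> to the boundary of the rectangle \<open>box (- r) r\<close>;
  no vector qualifies at the four corners, where the normal does not exist.\<close>

definition rectangle_normal :: "real^2 \<Rightarrow> real^2 \<Rightarrow> real^2 \<Rightarrow> bool" where
  "rectangle_normal r x n \<longleftrightarrow>
     (\<exists>i. \<bar>x $ i\<bar> = r $ i \<and> (\<forall>j. j \<noteq> i \<longrightarrow> \<bar>x $ j\<bar> < r $ j) \<and> n = axis i (sgn (x $ i)))"

definition gradient :: "(real^2 \<Rightarrow> real) \<Rightarrow> real^2 \<Rightarrow> real^2" where
  "gradient u x = (\<chi> i. frechet_derivative u (at x) (axis i 1))"

definition divergence :: "(real^2 \<Rightarrow> real^2) \<Rightarrow> real^2 \<Rightarrow> real" where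
  "divergence v x = (\<Sum>i\<in>UNIV. frechet_derivative v (at x) (axis i 1) $ i)"

text \<open>Time-dependent fields are curried, with time as the first argument. The following is
  membership in \<open>C\<^sup>1(I \<times> closure G)\<close>: the field is continuous on \<open>I \<times> closure G\<close>, and its space-time
  derivative on \<open>I \<times> G\<close> (one-sided in time at an endpoint of \<open>I\<close>) extends continuously
  to \<open>I \<times> closure G\<close>.\<close>

definition C1_up_to_boundary ::
    "real set \<Rightarrow> (real^2) set \<Rightarrow> (real \<Rightarrow> real^2 \<Rightarrow> 'b::real_normed_vector) \<Rightarrow> bool" where
  "C1_up_to_boundary I G u \<longleftrightarrow>
     continuous_on (I \<times> closure G) (\<lambda>(t, x). u t x) \<and>
     (\<exists>u' :: real \<times> (real^2) \<Rightarrow> (real \<times> (real^2)) \<Rightarrow>\<^sub>L 'b.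
        continuous_on (I \<times> closure G) u' \<and>
        (\<forall>z \<in> I \<times> G. ((\<lambda>(t, x). u t x) has_derivative blinfun_apply (u' z)) (at z within I \<times> G)))"

text \<open>Only the values for \<open>\<bar>s\<bar> \<le> \<alpha> + L\<close> matter.\<close>

definition damping_profile :: "real \<Rightarrow> real \<Rightarrow> real \<Rightarrow> real \<Rightarrow> real" where
  "damping_profile \<alpha> L \<xi>bar s =
     (if \<bar>s\<bar> < \<alpha> then 0
      else \<xi>bar * ((\<bar>s\<bar> - \<alpha>) / L - 1 / (2 * pi) * sin (2 * pi * (\<bar>s\<bar> - \<alpha>) / L)))"

definition diag :: "real^2 \<Rightarrow> real^2^2" where
  "diag v = (\<chi> i j. if i = j then v $ i else 0)"

text \<open>Below, \<open>\<xi>\<close> is the field \<open>x \<mapsto> (\<xi>\<^sub>1(x\<^sub>1), \<xi>\<^sub>2(x\<^sub>2))\<close>.\<close>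

definition Gamma1 :: "(real^2 \<Rightarrow> real^2) \<Rightarrow> real^2 \<Rightarrow> real^2^2" where
  "Gamma1 \<xi> x = diag (\<xi> x)"

definition Gamma2 :: "(real^2 \<Rightarrow> real^2) \<Rightarrow> real^2 \<Rightarrow> real^2^2" where
  "Gamma2 \<xi> x = diag (vector [\<xi> x $ 2 - \<xi> x $ 1, \<xi> x $ 1 - \<xi> x $ 2])"

definition Gamma1_tilde :: "(real^2 \<Rightarrow> real^2) \<Rightarrow> real^2 \<Rightarrow> real^2^2" where
  "Gamma1_tilde \<xi> x = Gamma1 \<xi> x + Gamma2 \<xi> x"

definition coeff_a :: "(real^2 \<Rightarrow> real^2) \<Rightarrow> real^2 \<Rightarrow> real" where
  "coeff_a \<xi> x = trace (Gamma1 \<xi> x)"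

definition coeff_b :: "(real^2 \<Rightarrow> real^2) \<Rightarrow> real^2 \<Rightarrow> real" where
  "coeff_b \<xi> x = det (Gamma1 \<xi> x)"

definition L2_inner :: "(real^2) set \<Rightarrow> (real^2 \<Rightarrow> 'b::real_inner) \<Rightarrow> (real^2 \<Rightarrow> 'b) \<Rightarrow> real" where
  "L2_inner G u v = (LINT x:G|lborel. u x \<bullet> v x)"

definition L2_norm :: "(real^2) set \<Rightarrow> (real^2 \<Rightarrow> 'b::real_inner) \<Rightarrow> real" where
  "L2_norm G u = sqrt (L2_inner G u u)"

text \<open>The squared weighted norm \<open>(\<omega>u, u)\<close> for a scalar weight and for a matrix weight.\<close>

definition wnorm2 :: "(real^2) set \<Rightarrow> (real^2 \<Rightarrow> real) \<Rightarrow> (real^2 \<Rightarrow> 'b::real_inner) \<Rightarrow> real" where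
  "wnorm2 G \<omega> u = L2_inner G (\<lambda>x. \<omega> x *\<^sub>R u x) u"

definition mnorm2 :: "(real^2) set \<Rightarrow> (real^2 \<Rightarrow> real^2^2) \<Rightarrow> (real^2 \<Rightarrow> real^2) \<Rightarrow> real" where
  "mnorm2 G \<omega> u = L2_inner G (\<lambda>x. \<omega> x *v u x) u"

text \<open>Since \<open>inverse 0 = 0\<close>, the weights containing the inverse of \<open>a\<close> vanish where \<open>a = 0\<close>,
  which is the intended convention.\<close>

definition energy ::
    "(real^2 \<Rightarrow> real^2) \<Rightarrow> (real^2) set \<Rightarrow> (real \<Rightarrow> real^2 \<Rightarrow> real) \<Rightarrow> (real \<Rightarrow> real^2 \<Rightarrow> real) \<Rightarrow>
     (real \<Rightarrow> real^2 \<Rightarrow> real^2) \<Rightarrow> (real \<Rightarrow> real^2 \<Rightarrow> real^2) \<Rightarrow> real \<Rightarrow> real" where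
  "energy \<xi> G p q chi lam t =
     1/2 * ((L2_norm G (q t))\<^sup>2 + (L2_norm G (chi t))\<^sup>2 + wnorm2 G (coeff_b \<xi>) (p t)
       + mnorm2 G (\<lambda>x. inverse (coeff_a \<xi> x) *\<^sub>R Gamma1 \<xi> x) (lam t))"

definition dissipation ::
    "(real^2 \<Rightarrow> real^2) \<Rightarrow> (real^2) set \<Rightarrow> (real \<Rightarrow> real^2 \<Rightarrow> real) \<Rightarrow>
     (real \<Rightarrow> real^2 \<Rightarrow> real^2) \<Rightarrow> (real \<Rightarrow> real^2 \<Rightarrow> real^2) \<Rightarrow> real \<Rightarrow> real" where
  "dissipation \<xi> G p chi lam t =
     wnorm2 G (\<lambda>x. coeff_a \<xi> x * coeff_b \<xi> x) (p t)
     + mnorm2 G (\<lambda>x. Gamma1 \<xi> x + inverse (coeff_a \<xi> x) *\<^sub>R (Gamma1 \<xi> x ** Gamma1 \<xi> x)) (chi t)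
     + wnorm2 G (\<lambda>x. inverse (coeff_a \<xi> x) * coeff_b \<xi> x) (\<lambda>x. chi t x - lam t x)"

end

theory Submission
  imports Defs
begin

text \<open>Differentiating the energy under the integral sign and inserting the equations, the
  identities \<open>\<Gamma>\<^sub>1 (\<Gamma>\<^sub>1 + \<Gamma>\<^sub>2) = b\<close>, \<open>\<Gamma>\<^sub>1 \<Gamma>\<^sub>2 = b - \<Gamma>\<^sub>1\<^sup>2\<close> and \<open>a \<Gamma>\<^sub>1 = \<Gamma>\<^sub>1\<^sup>2 + b\<close>
  turn the integrand into \<open>c div (q \<chi>)\<close> minus the dissipation density. Integrating \<open>p\<^sub>t = q - a p\<close>
  in time, the boundary condition \<open>p = 0\<close> forces \<open>q = 0\<close> on the whole boundary, so that
  \<open>div (q \<chi>)\<close> integrates to zero: along each line parallel to an axis the domain is a countable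
  union of open intervals at whose endpoints \<open>q \<chi>\<close> vanishes.\<close>

section \<open>Integrals of derivatives of functions that vanish on the frontier\<close>

text \<open>Each component of \<open>U\<close> is an open interval whose end points lie in the
  frontier of \<open>U\<close>, so the fundamental theorem of calculus gives 0 on it. Absolute
  integrability of \<open>g\<close> carries this over from finite unions of components to the
  countable union.\<close>

lemma integral_derivative_eq_0_on_open:
  fixes f g :: "real \<Rightarrow> real"
  assumes U: "open U" "bounded U"
    and cont: "continuous_on (closure U) f"
    and zero: "\<And>x. x \<in> frontier U \<Longrightarrow> f x = 0"
    and deriv: "\<And>x. x \<in> U \<Longrightarrow> (f has_real_derivative g x) (at x)"
    and abs: "g absolutely_integrable_on U"
  shows "integral U g = 0"
proof (cases "U = {}")
  case False
  have comp: "(g has_integral 0) C" if C: "C \<in> components U" for C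
  proof -
    have Cp: "open C" "connected C" "C \<noteq> {}" "C \<subseteq> U"
      using C U open_components in_components_connected in_components_nonempty in_components_subset
      by blast+
    have "bounded C" using Cp U bounded_subset by blast
    then have "connected (closure C)" "compact (closure C)"
      using Cp by (auto intro: connected_imp_connected_closure)
    then obtain a b where ab: "closure C = {a..b}"
      using connected_compact_interval_1 by (metis cbox_interval)
    \<comment> \<open>A connected set of reals is convex, and an open convex set is the interior of
      its closure; this leads from the closed interval \<open>{a..b}\<close> back to
      \<open>C\<close>.\<close>
    have "C = interior (closure C)"
      using Cp convex_interior_closure connected_convex_1 interior_open by metis
    then have C_eq: "C = {a<..<b}" by (simp add: ab)
    then have "a < b" using Cp by auto
    have "frontier C = {a, b}"
      unfolding frontier_def ab using \<open>a < b\<close> Cp(1) C_eq by (auto simp: interior_open)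
    then have "f a = 0" "f b = 0"
      using frontier_of_components_subset[OF C] zero by auto
    moreover have "(g has_integral (f b - f a)) {a..b}"
    proof (rule fundamental_theorem_of_calculus_interior)
      show "continuous_on {a..b} f"
        using cont closure_mono[OF Cp(4)] ab continuous_on_subset by metis
      show "(f has_vector_derivative g x) (at x)" if "x \<in> {a<..<b}" for x
        using deriv that Cp(4) C_eq has_real_derivative_iff_has_vector_derivative by blast
    qed (use \<open>a < b\<close> in simp)
    ultimately show ?thesis
      using has_integral_open_interval[of g 0 a b] C_eq by simp
  qed
  \<comment> \<open>The enumeration repeats components when there are only finitely many, so the
    integral over a partial union is a sum over the set of components reached, not over
    indices.\<close>
  let ?s = "from_nat_into (components U)"
  have ne: "components U \<noteq> {}" using False by simp
  have cnt: "countable (components U)"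
    using pairwise_disjoint_components[of U] open_components[OF U(1)]
    unfolding pairwise_def by (intro countable_disjoint_open_subsets disjointI) blast+
  have rng: "range ?s = components U"
    using range_from_nat_into[OF ne cnt] .
  have UN: "\<Union> (range ?s) = U" by (simp add: rng Union_components[symmetric])
  have s: "?s n \<in> components U" for n using from_nat_into[OF ne] .
  have leb: "?s n \<in> sets lebesgue" for n
    using open_components[OF U(1) s] by (intro sets_completionI_sets) simp
  have UN_eq: "(\<Union>n. \<Union>m\<le>n. ?s m) = U"
    by (rule trans[OF _ UN]) auto
  have int0: "integral (\<Union>m\<le>n. ?s m) g = 0" for n
  proof -
    have "(g has_integral (\<Sum>C\<in>?s ` {..n}. 0)) (\<Union> (?s ` {..n}))"
    proof (rule has_integral_Union)
      show "pairwise (\<lambda>S S'. negligible (S \<inter> S')) (?s ` {..n})"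
        using pairwise_disjoint_components[of U] s
        by (auto simp: pairwise_def disjnt_def)
    qed (use comp s in auto)
    then show ?thesis by (simp add: integral_unique)
  qed
  have zero_int: "(LINT x:(\<Union>m\<le>n. ?s m)|lebesgue. g x) = 0" for n
  proof -
    have "g absolutely_integrable_on (\<Union>m\<le>n. ?s m)"
    proof (rule set_integrable_subset[OF abs])
      show "(\<Union>m\<le>n. ?s m) \<in> sets lebesgue" by (intro sets.finite_UN leb) auto
      show "(\<Union>m\<le>n. ?s m) \<subseteq> U" by (rule order_trans[OF _ equalityD1[OF UN_eq]]) auto
    qed
    from set_lebesgue_integral_eq_integral(2)[OF this] int0[of n] show ?thesis by (rule trans)
  qed
  have "(\<lambda>n. LINT x:(\<Union>m\<le>n. ?s m)|lebesgue. g x) \<longlonglongrightarrow> (LINT x:(\<Union>n. \<Union>m\<le>n. ?s m)|lebesgue. g x)"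
  proof (rule set_integral_cont_up)
    show "incseq (\<lambda>n. \<Union>m\<le>n. ?s m)" unfolding incseq_def by (intro allI impI UN_mono) auto
    show "set_integrable lebesgue (\<Union>n. \<Union>m\<le>n. ?s m) g"
      unfolding UN_eq by (rule abs)
    show "(\<Union>m\<le>n. ?s m) \<in> sets lebesgue" for n
      by (intro sets.finite_UN leb) auto
  qed
  then have "(LINT x:U|lebesgue. g x) = 0"
    unfolding UN_eq zero_int LIMSEQ_const_iff by (rule sym)
  then show ?thesis
    unfolding set_lebesgue_integral_eq_integral(2)[OF abs] .
qed simp

text \<open>The index \<open>i\<close> stays a parameter so that one Fubini argument serves both
  partial derivatives, always with the differentiated variable innermost.\<close>

definition plane_point :: "2 \<Rightarrow> real \<Rightarrow> real \<Rightarrow> real^2" where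
  "plane_point i s r = (\<chi> k. if k = i then s else r)"

lemma plane_point_eq: "plane_point i s r = plane_point i 0 r + s *\<^sub>R axis i 1"
  by (auto simp: plane_point_def vec_eq_iff axis_def)

lemma continuous_on_plane_point: "continuous_on S (\<lambda>z. plane_point i (fst z) (snd z))"
  unfolding plane_point_def
proof (rule continuous_on_vec_lambda)
  show "continuous_on S (\<lambda>z::real \<times> real. if k = i then fst z else snd z)" for k
    by (cases "k = i") (auto intro: continuous_intros)
qed

lemma measurable_plane_point [measurable]: "(\<lambda>(s, r). plane_point i s r) \<in> borel_measurable borel"
  unfolding case_prod_beta by (rule borel_measurable_continuous_onI[OF continuous_on_plane_point])

text \<open>Lebesgue measure is determined by its values on boxes, and the preimage of a box is a
  box with the same side lengths. This gives Fubini in the plane with either coordinate as the inner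
  variable.\<close>

lemma lborel_eq_distr_plane_point: "lborel = distr lborel borel (\<lambda>(s, r). plane_point i s r)"
    (is "_ = distr _ _ ?h")
proof (rule lborel_eqI)
  obtain j :: 2 where j: "j \<noteq> i" using exhaust_2 by (metis zero_neq_one)
  have U: "UNIV = {i, j}"
    using j exhaust_2 by (metis (full_types) UNIV_eq_I insertCI)
  fix l u :: "real^2" assume le: "\<And>b. b \<in> Basis \<Longrightarrow> l \<bullet> b \<le> u \<bullet> b"
  have lk: "l $ k \<le> u $ k" for k
    using le[of "axis k 1"] by (simp add: inner_axis axis_in_Basis_iff)
  have all: "(\<forall>k. Q k) \<longleftrightarrow> Q i \<and> Q j" for Q :: "2 \<Rightarrow> bool"
    using U by (metis (full_types) UNIV_I insertE singletonD)
  have pre: "?h -` box l u = box (l $ i, l $ j) (u $ i, u $ j)"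
    using j by (auto simp: box_def mem_box_cart all Basis_prod_def plane_point_def inner_axis
        Basis_vec_def)
  have "emeasure (distr lborel borel ?h) (box l u) = emeasure lborel (box (l $ i, l $ j) (u $ i, u $ j))"
    by (subst emeasure_distr) (auto simp: pre)
  also have "\<dots> = (u $ i - l $ i) * (u $ j - l $ j)"
    using lk by (subst emeasure_lborel_box) (auto simp: Basis_prod_def prod.union_disjoint)
  also have "\<dots> = (\<Prod>b\<in>Basis. (u - l) \<bullet> b)"
  proof -
    have B: "Basis = {axis i 1, axis j 1 :: real^2}"
      using U by (auto simp: Basis_vec_def)
    have "axis i (1::real) \<noteq> axis j 1" using j by (simp add: axis_eq_axis)
    then have "(\<Prod>b\<in>Basis. (u - l) \<bullet> b) = ((u - l) \<bullet> axis i 1) * ((u - l) \<bullet> axis j 1)"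
      unfolding B by simp
    then show ?thesis by (simp add: inner_axis)
  qed
  finally show "emeasure (distr lborel borel ?h) (box l u) = (\<Prod>b\<in>Basis. (u - l) \<bullet> b)" .
qed simp

text \<open>By Fubini it suffices to integrate along lines in direction \<open>i\<close>. The slice
  of \<open>G\<close> by such a line is open and bounded but may have infinitely many components,
  the situation that \<open>integral_derivative_eq_0_on_open\<close> handles.\<close>

lemma integral_partial_derivative_zero:
  fixes G :: "(real^2) set" and w :: "real^2 \<Rightarrow> real"
  assumes G: "open G" "bounded G"
    and cont: "continuous_on (closure G) w"
    and zero: "\<And>x. x \<in> frontier G \<Longrightarrow> w x = 0"
    and deriv: "\<And>x. x \<in> G \<Longrightarrow> (w has_derivative w' x) (at x)"
    and meas: "(\<lambda>x. w' x (axis i 1)) \<in> borel_measurable (restrict_space lborel G)"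
    and bound: "\<And>x. x \<in> G \<Longrightarrow> \<bar>w' x (axis i 1)\<bar> \<le> B"
  shows "integral\<^sup>L (restrict_space lborel G) (\<lambda>x. w' x (axis i 1)) = 0"
proof -
  \<comment> \<open>Extension by zero lets Fubini run over whole lines rather than over slices that
    vary with \<open>r\<close>.\<close>
  define h where "h x = indicator G x *\<^sub>R w' x (axis i 1)" for x
  let ?P = "\<lambda>(s, r). plane_point i s r"
  have Gb[measurable]: "G \<in> sets borel" using G(1) by simp
  have hm[measurable]: "h \<in> borel_measurable borel"
  proof -
    have "G \<inter> space lborel \<in> sets lborel" by simp
    from meas[unfolded borel_measurable_restrict_space_iff[OF this]] show ?thesis
      unfolding h_def[abs_def] measurable_lborel2 .
  qed
  have hint: "integrable lborel h"
  proof (rule integrableI_bounded_set[where A = G and B = B])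
    show "emeasure lborel G < \<infinity>" using G(2) by (rule emeasure_bounded_finite)
  qed (use bound in \<open>auto simp: h_def\<close>)
  have pint: "integrable (lborel \<Otimes>\<^sub>M lborel) (\<lambda>z. h (?P z))"
  proof -
    have "integrable (distr lborel borel ?P) h"
      using lborel_eq_distr_plane_point[of i] hint by (rule subst)
    then have "integrable lborel (\<lambda>z. h (?P z))"
      by (rule integrable_distr[rotated]) simp
    then show ?thesis by (simp only: lborel_prod)
  qed
  have inner0: "(\<integral>s. h (plane_point i s r) \<partial>lborel) = 0" for r
  proof -
    define U where "U = {s. plane_point i s r \<in> G}"
    have cline: "continuous_on S (\<lambda>s. plane_point i s r)" for S
      by (subst plane_point_eq) (intro continuous_intros)
    have oU: "open U"
      using open_vimage[OF G(1) cline] by (simp add: U_def vimage_def)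
    obtain K where K: "\<And>x. x \<in> G \<Longrightarrow> norm x \<le> K" using G(2) bounded_iff by blast
    have "\<bar>s\<bar> \<le> K" if "s \<in> U" for s
      using K[of "plane_point i s r"] component_le_norm_cart[of "plane_point i s r" i] that
      by (auto simp: U_def plane_point_def)
    then have bU: "bounded U" by (auto simp: bounded_iff)
    have cU: "plane_point i s r \<in> closure G" if "s \<in> closure U" for s
    proof -
      have "(\<lambda>s. plane_point i s r) ` closure U \<subseteq> closure ((\<lambda>s. plane_point i s r) ` U)"
        by (rule image_closure_subset[OF cline]) (auto simp: closure_subset)
      also have "\<dots> \<subseteq> closure G" by (rule closure_mono) (auto simp: U_def)
      finally show ?thesis using that by blast
    qed
    have meq: "(\<lambda>s. indicator U s *\<^sub>R w' (plane_point i s r) (axis i 1)) = (\<lambda>s. h (plane_point i s r))"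
      by (auto simp: h_def U_def indicator_def)
    have hs: "(\<lambda>s. h (plane_point i s r)) \<in> borel_measurable borel"
      using borel_measurable_continuous_onI[OF cline] by measurable
    have sint: "set_integrable lborel U (\<lambda>s. w' (plane_point i s r) (axis i 1))"
      unfolding set_integrable_def meq
    proof (rule integrableI_bounded_set[where A = U and B = B])
      show "emeasure lborel U < \<infinity>" using bU by (rule emeasure_bounded_finite)
    qed (use bound oU hs in \<open>auto simp: h_def U_def\<close>)
    have "integral U (\<lambda>s. w' (plane_point i s r) (axis i 1)) = 0"
    proof (rule integral_derivative_eq_0_on_open[OF oU bU, of "\<lambda>s. w (plane_point i s r)"])
      show "continuous_on (closure U) (\<lambda>s. w (plane_point i s r))"
        by (rule continuous_on_compose2[OF cont cline]) (use cU in auto)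
      \<comment> \<open>A frontier point of the open slice is not in the slice, so its image is in
        \<open>closure G\<close> but outside the open set \<open>G\<close>, hence on the
        frontier.\<close>
      show "w (plane_point i s r) = 0" if "s \<in> frontier U" for s
        using that cU[of s] zero oU G(1) by (auto simp: frontier_def interior_open U_def)
      show "((\<lambda>s. w (plane_point i s r)) has_real_derivative w' (plane_point i s r) (axis i 1)) (at s)"
        if "s \<in> U" for s
      proof -
        have "((\<lambda>s. plane_point i s r) has_vector_derivative axis i 1) (at s)"
          by (subst plane_point_eq) (auto intro!: derivative_eq_intros)
        then have "((w \<circ> (\<lambda>s. plane_point i s r)) has_vector_derivative w' (plane_point i s r) (axis i 1)) (at s)"
          using deriv[of "plane_point i s r"] that
          by (intro vector_derivative_diff_chain_within) (auto simp: U_def intro: has_derivative_at_withinI)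
        then show ?thesis by (simp add: has_real_derivative_iff_has_vector_derivative o_def)
      qed
      show "(\<lambda>s. w' (plane_point i s r) (axis i 1)) absolutely_integrable_on U"
        using sint unfolding set_integrable_def by (simp add: integrable_completion hs meq)
    qed
    with set_borel_integral_eq_integral(2)[OF sint] show ?thesis
      unfolding set_lebesgue_integral_def meq by (rule trans)
  qed
  have "integral\<^sup>L (restrict_space lborel G) (\<lambda>x. w' x (axis i 1)) = integral\<^sup>L lborel h"
    by (subst integral_restrict_space) (simp_all add: h_def[abs_def])
  also have "\<dots> = integral\<^sup>L (lborel \<Otimes>\<^sub>M lborel) (\<lambda>z. h (?P z))"
    by (subst lborel_eq_distr_plane_point[of i], subst integral_distr) (auto simp: lborel_prod)
  also have "\<dots> = (\<integral>r. (\<integral>s. h (plane_point i s r) \<partial>lborel) \<partial>lborel)"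
    using lborel_pair.integral_snd[of "\<lambda>s r. h (plane_point i s r)"] pint
    by (simp add: case_prod_beta')
  finally show ?thesis by (simp add: inner0)
qed

section \<open>Derivatives in time: under the integral sign and on the frontier\<close>

text \<open>The mean value theorem on the convex set \<open>S\<close> bounds all difference
  quotients by \<open>g\<close>, so dominated convergence applies along every sequence in
  \<open>S\<close> tending to \<open>t\<close>. Working within \<open>S\<close> includes one-sided
  derivatives at an end point.\<close>

lemma has_real_derivative_integral_dominated:
  fixes f f' :: "real \<Rightarrow> 'a \<Rightarrow> real"
  assumes "convex S" "t \<in> S"
    and int: "\<And>s. s \<in> S \<Longrightarrow> integrable M (f s)"
    and deriv: "\<And>s x. s \<in> S \<Longrightarrow> x \<in> space M \<Longrightarrow>
        ((\<lambda>s. f s x) has_real_derivative f' s x) (at s within S)"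
    and bound: "\<And>s x. s \<in> S \<Longrightarrow> x \<in> space M \<Longrightarrow> \<bar>f' s x\<bar> \<le> g x"
    and meas: "f' t \<in> borel_measurable M"
    and g: "integrable M g"
  shows "((\<lambda>s. integral\<^sup>L M (f s)) has_real_derivative integral\<^sup>L M (f' t)) (at t within S)"
  unfolding has_field_derivative_iff tendsto_at_iff_sequentially comp_def
proof safe
  fix X :: "nat \<Rightarrow> real" assume X: "\<forall>n. X n \<in> S - {t}" "X \<longlonglongrightarrow> t"
  have "(\<lambda>n. integral\<^sup>L M (\<lambda>x. (f (X n) x - f t x) / (X n - t))) \<longlonglongrightarrow> integral\<^sup>L M (f' t)"
  proof (rule integral_dominated_convergence[where w = g])
    show "(\<lambda>x. (f (X n) x - f t x) / (X n - t)) \<in> borel_measurable M" for n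
      using int[of "X n"] int[of t] X assms(2) by (intro borel_measurable_integrable) auto
    show "AE x in M. (\<lambda>n. (f (X n) x - f t x) / (X n - t)) \<longlonglongrightarrow> f' t x"
      using deriv[OF assms(2)] X
      unfolding has_field_derivative_iff tendsto_at_iff_sequentially comp_def by auto
    show "AE x in M. norm ((f (X n) x - f t x) / (X n - t)) \<le> g x" for n
    proof (rule AE_I2)
      fix x assume x: "x \<in> space M"
      have "norm (f (X n) x - f t x) \<le> g x * norm (X n - t)"
        using field_differentiable_bound[of S "\<lambda>s. f s x" "\<lambda>s. f' s x" "g x" "X n" t]
          deriv[OF _ x] bound[OF _ x] assms(1,2) X by auto
      then show "norm ((f (X n) x - f t x) / (X n - t)) \<le> g x"
        using X by (simp add: divide_le_eq)
    qed
  qed (use meas g in auto)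
  moreover have "integral\<^sup>L M (\<lambda>x. (f (X n) x - f t x) / (X n - t))
      = (integral\<^sup>L M (f (X n)) - integral\<^sup>L M (f t)) / (X n - t)" for n
    using int X assms(2) by auto
  moreover have "X n \<noteq> t" for n using X by auto
  ultimately show "(\<lambda>n. (integral\<^sup>L M (f (X n)) - integral\<^sup>L M (f t)) / (X n - t))
      \<longlonglongrightarrow> integral\<^sup>L M (f' t)" by simp
qed

text \<open>The differential relation between \<open>u\<close> and \<open>r\<close> is given inside
  \<open>G\<close>, so it is integrated in time first; the integrated form passes to
  \<open>closure G\<close> by continuity. Where \<open>u\<close> vanishes at all times so do the
  integrals of \<open>r\<close>, and differentiating in the upper limit recovers
  \<open>r t x\<close>.\<close>

lemma time_derivative_zero_on_frontier:
  fixes u r :: "real \<Rightarrow> 'a::t2_space \<Rightarrow> real"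
  assumes contu: "continuous_on ({0<..T} \<times> closure G) (\<lambda>(t, x). u t x)"
    and contr: "continuous_on ({0<..T} \<times> closure G) (\<lambda>(t, x). r t x)"
    and deriv: "\<And>t x. t \<in> {0<..T} \<Longrightarrow> x \<in> G \<Longrightarrow>
      ((\<lambda>s. u s x) has_vector_derivative r t x) (at t within {0<..T})"
    and x: "x \<in> closure G" and zero: "\<And>t. t \<in> {0<..T} \<Longrightarrow> u t x = 0"
    and t: "t \<in> {0<..T}"
  shows "r t x = 0"
proof -
  \<comment> \<open>Starting at \<open>t / 2\<close> keeps the time interval compact inside
    \<open>{0<..T}\<close>. With \<open>t\<close> as right end point a derivative from the left is
    enough, which also covers \<open>t = T\<close>.\<close>
  have pos: "0 < t / 2" "t / 2 < t" "t \<le> T" using t by auto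
  have slice: "continuous_on (closure G) (u s)" if "s \<in> {0<..T}" for s
    by (rule continuous_on_compose2[OF contu, of "closure G" "\<lambda>x. (s, x)", simplified])
       (use that in \<open>auto intro!: continuous_intros\<close>)
  have int0: "integral {t/2..\<tau>} (\<lambda>s. r s x) = 0" if \<tau>: "\<tau> \<in> {t/2..t}" for \<tau>
  proof -
    have sub: "{t/2..\<tau>} \<subseteq> {0<..T}" using \<tau> pos by auto
    have c: "continuous_on (closure G) (\<lambda>y. integral (cbox (t/2) \<tau>) (\<lambda>s. r s y))"
    proof (rule integral_continuous_on_param)
      show "continuous_on (closure G \<times> cbox (t/2) \<tau>) (\<lambda>(y, s). r s y)"
        unfolding case_prod_beta
        by (rule continuous_on_compose2[OF contr, of _ "\<lambda>z. (snd z, fst z)", simplified case_prod_beta fst_conv snd_conv])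
           (use sub in \<open>auto intro!: continuous_intros\<close>)
    qed
    have "(\<lambda>y. integral {t/2..\<tau>} (\<lambda>s. r s y) - (u \<tau> y - u (t/2) y)) x = 0"
    proof (rule continuous_constant_on_closure[OF _ _ x])
      show "continuous_on (closure G) (\<lambda>y. integral {t/2..\<tau>} (\<lambda>s. r s y) - (u \<tau> y - u (t/2) y))"
        using c slice[of \<tau>] slice[of "t/2"] sub \<tau> by (auto intro!: continuous_intros)
      fix y assume y: "y \<in> G"
      have "((\<lambda>s. r s y) has_integral (u \<tau> y - u (t/2) y)) {t/2..\<tau>}"
        by (rule fundamental_theorem_of_calculus)
           (use \<tau> sub y in \<open>auto intro!: has_vector_derivative_within_subset[OF deriv]\<close>)
      then show "integral {t/2..\<tau>} (\<lambda>s. r s y) - (u \<tau> y - u (t/2) y) = 0"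
        by (simp add: integral_unique)
    qed
    then show ?thesis using zero[of \<tau>] zero[of "t/2"] sub \<tau> by auto
  qed
  have "continuous_on {t/2..t} (\<lambda>s. r s x)"
    by (rule continuous_on_compose2[OF contr, of _ "\<lambda>s. (s, x)", simplified])
       (use x pos in \<open>auto intro!: continuous_intros\<close>)
  from integral_has_vector_derivative[OF this, of t] pos
  have 1: "((\<lambda>\<tau>. integral {t/2..\<tau>} (\<lambda>s. r s x)) has_vector_derivative r t x) (at t within {t/2..t})"
    by auto
  have "((\<lambda>_. 0::real) has_vector_derivative r t x) (at t within {t/2..t})"
    by (rule has_vector_derivative_transform[OF _ _ 1]) (use int0 pos in auto)
  moreover have "((\<lambda>_. 0::real) has_vector_derivative 0) (at t within {t/2..t})" by simp
  ultimately show ?thesis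
    using vector_derivative_unique_within_closed_interval[of "t/2" t t] pos
    by (metis atLeastAtMost_iff box_real(2) less_eq_real_def)
qed

section \<open>Measurability, bounds and spatial derivatives of fields of class C1 up to the
  boundary\<close>

lemma measurable_continuous_on_restrict_lborel:
  assumes "continuous_on G f"
  shows "f \<in> borel_measurable (restrict_space lborel G)"
  using borel_measurable_continuous_on_restrict[OF assms]
  by (simp cong: measurable_cong_sets add: sets_restrict_space)

lemma integrable_restrict_lborel_bounded:
  fixes f :: "'a::euclidean_space \<Rightarrow> real"
  assumes "open G" "bounded G" "f \<in> borel_measurable (restrict_space lborel G)" "bounded (f ` G)"
  shows "integrable (restrict_space lborel G) f"
proof -
  obtain B where "\<And>x. x \<in> G \<Longrightarrow> norm (f x) \<le> B"
    using assms(4) by (auto simp: bounded_iff)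
  moreover have "emeasure lborel G < \<infinity>" using assms(2) by (rule emeasure_bounded_finite)
  ultimately show ?thesis
    using assms(1,3)
    by (intro integrableI_bounded_set[where A = G and B = B])
       (auto simp: emeasure_restrict_space space_restrict_space sets_restrict_space)
qed

lemma C1_up_to_boundary_continuous:
  "C1_up_to_boundary I G u \<Longrightarrow> continuous_on (I \<times> closure G) (\<lambda>(t, x). u t x)"
  by (simp add: C1_up_to_boundary_def)

lemma C1_up_to_boundary_continuous_slice:
  assumes "C1_up_to_boundary I G u" "t \<in> I"
  shows "continuous_on (closure G) (u t)"
proof -
  have "continuous_on (closure G) (Pair t)" by (intro continuous_intros)
  from continuous_on_compose2[OF C1_up_to_boundary_continuous[OF assms(1)] this] assms(2)
  show ?thesis by auto
qed

text \<open>Restricting the space-time derivative to directions \<open>(0, h)\<close> gives the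
  spatial one; as \<open>G\<close> is open, it is the full derivative at \<open>x\<close>. The
  extension \<open>u'\<close> to the closure is kept, since it is the source of continuity and
  bounds for \<open>frechet_derivative\<close>.\<close>

lemma C1_up_to_boundary_spatial_derivative:
  assumes C1: "C1_up_to_boundary I G u" and G: "open G"
  shows "\<exists>u'. continuous_on (I \<times> closure G) u' \<and>
    (\<forall>t\<in>I. \<forall>x\<in>G. (u t has_derivative (\<lambda>h. blinfun_apply (u' (t, x)) (0 :: real, h))) (at x))"
proof -
  obtain u' where u': "continuous_on (I \<times> closure G) u'"
    and d: "\<And>z. z \<in> I \<times> G \<Longrightarrow>
      ((\<lambda>(t, x). u t x) has_derivative blinfun_apply (u' z)) (at z within I \<times> G)"
    using C1 unfolding C1_up_to_boundary_def by blast
  have dx: "(u t has_derivative (\<lambda>h. blinfun_apply (u' (t, x)) (0 :: real, h))) (at x)"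
    if t: "t \<in> I" and x: "x \<in> G" for t x
  proof -
    have "((\<lambda>y. (t, y)) has_derivative (\<lambda>h. (0 :: real, h))) (at x within G)"
      by (auto intro!: derivative_eq_intros)
    moreover have "((\<lambda>(t, x). u t x) has_derivative blinfun_apply (u' (t, x))) (at (t, x) within (\<lambda>y. (t, y)) ` G)"
      by (rule has_derivative_subset[OF d]) (use t x in auto)
    ultimately have "(((\<lambda>(t, x). u t x) \<circ> (\<lambda>y. (t, y))) has_derivative
        (blinfun_apply (u' (t, x)) \<circ> (\<lambda>h. (0 :: real, h)))) (at x within G)"
      by (rule diff_chain_within)
    then show ?thesis
      unfolding at_within_open[OF x G] by (simp add: o_def)
  qed
  show ?thesis by (intro exI[of _ u'] conjI ballI u' dx)
qed

lemma C1_up_to_boundary_differentiable: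
  assumes "C1_up_to_boundary I G u" "open G" "t \<in> I" "x \<in> G"
  shows "(u t has_derivative frechet_derivative (u t) (at x)) (at x)"
proof -
  obtain u' where "\<And>t x. t \<in> I \<Longrightarrow> x \<in> G \<Longrightarrow>
      (u t has_derivative (\<lambda>h. blinfun_apply (u' (t, x)) (0 :: real, h))) (at x)"
    using C1_up_to_boundary_spatial_derivative[OF assms(1,2)] by blast
  from this[OF assms(3,4)] show ?thesis
    unfolding frechet_derivative_works[symmetric] by (rule differentiableI)
qed

lemma C1_up_to_boundary_derivative_continuous:
  assumes "C1_up_to_boundary I G u" "open G" "t \<in> I"
  shows "continuous_on G (\<lambda>x. frechet_derivative (u t) (at x) h)"
proof -
  obtain u' where u': "continuous_on (I \<times> closure G) u'"
    "\<And>t x. t \<in> I \<Longrightarrow> x \<in> G \<Longrightarrow> (u t has_derivative (\<lambda>h. blinfun_apply (u' (t, x)) (0 :: real, h))) (at x)"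
    using C1_up_to_boundary_spatial_derivative[OF assms(1,2)] by blast
  have "continuous_on G (\<lambda>x. blinfun_apply (u' (t, x)) (0 :: real, h))"
  proof (rule blinfun.continuous_on[OF continuous_on_compose2[OF u'(1)] continuous_on_const])
    show "continuous_on G (Pair t)" by (intro continuous_intros)
    show "Pair t ` G \<subseteq> I \<times> closure G" using assms(3) closure_subset by auto
  qed
  moreover have "blinfun_apply (u' (t, x)) (0 :: real, h) = frechet_derivative (u t) (at x) h" if "x \<in> G" for x
    using fun_cong[OF frechet_derivative_at[OF u'(2)[OF assms(3) that]], of h] .
  ultimately show ?thesis by (rule continuous_on_eq)
qed

text \<open>Continuity on the compact set \<open>J \<times> closure G\<close> gives the bound. The
  times are confined to a compact \<open>J\<close> because a field may blow up at an end point
  missing from \<open>I\<close>; uniformity over \<open>J\<close> later provides a constant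
  dominating function.\<close>

lemma C1_up_to_boundary_bounded:
  assumes C1: "C1_up_to_boundary I G u" and G: "bounded G" and J: "compact J" "J \<subseteq> I"
  shows "bounded ((\<lambda>z. u (fst z) (snd z)) ` (J \<times> G))"
proof -
  have "compact ((\<lambda>(t, x). u t x) ` (J \<times> closure G))"
  proof (rule compact_continuous_image)
    show "continuous_on (J \<times> closure G) (\<lambda>(t, x). u t x)"
      by (rule continuous_on_subset[OF C1_up_to_boundary_continuous[OF C1]]) (use J(2) in auto)
    show "compact (J \<times> closure G)" using J(1) G by (simp add: compact_Times compact_closure)
  qed
  moreover have "(\<lambda>z. u (fst z) (snd z)) ` (J \<times> G) \<subseteq> (\<lambda>(t, x). u t x) ` (J \<times> closure G)"
    using closure_subset[of G] by force
  ultimately show ?thesis using bounded_subset compact_imp_bounded by blast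
qed

text \<open>By uniqueness of derivatives, \<open>frechet_derivative\<close> agrees on
  \<open>J \<times> G\<close> with a function that is continuous on the compact set
  \<open>J \<times> closure G\<close>.\<close>

lemma C1_up_to_boundary_derivative_bounded:
  assumes C1: "C1_up_to_boundary I G u" and G: "open G" "bounded G" and J: "compact J" "J \<subseteq> I"
  shows "bounded ((\<lambda>z. frechet_derivative (u (fst z)) (at (snd z)) h) ` (J \<times> G))"
proof -
  obtain u' where u': "continuous_on (I \<times> closure G) u'"
    "\<And>t x. t \<in> I \<Longrightarrow> x \<in> G \<Longrightarrow> (u t has_derivative (\<lambda>h. blinfun_apply (u' (t, x)) (0 :: real, h))) (at x)"
    using C1_up_to_boundary_spatial_derivative[OF C1 G(1)] by blast
  have "compact ((\<lambda>z. blinfun_apply (u' z) (0 :: real, h)) ` (J \<times> closure G))"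
  proof (rule compact_continuous_image)
    show "continuous_on (J \<times> closure G) (\<lambda>z. blinfun_apply (u' z) (0 :: real, h))"
      by (rule blinfun.continuous_on[OF continuous_on_subset[OF u'(1)] continuous_on_const])
         (use J(2) in auto)
    show "compact (J \<times> closure G)" using J(1) G(2) by (simp add: compact_Times compact_closure)
  qed
  moreover have "(\<lambda>z. frechet_derivative (u (fst z)) (at (snd z)) h) ` (J \<times> G)
      \<subseteq> (\<lambda>z. blinfun_apply (u' z) (0 :: real, h)) ` (J \<times> closure G)"
  proof (rule image_subsetI)
    fix z assume z: "z \<in> J \<times> G"
    then have "(\<lambda>h. blinfun_apply (u' (fst z, snd z)) (0 :: real, h)) = frechet_derivative (u (fst z)) (at (snd z))"
      using J(2) by (intro frechet_derivative_at u'(2)) auto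
    from fun_cong[OF this, of h]
    have "frechet_derivative (u (fst z)) (at (snd z)) h = blinfun_apply (u' z) (0 :: real, h)" by simp
    moreover have "z \<in> J \<times> closure G" using z closure_subset by fastforce
    ultimately show "frechet_derivative (u (fst z)) (at (snd z)) h
      \<in> (\<lambda>z. blinfun_apply (u' z) (0 :: real, h)) ` (J \<times> closure G)" by blast
  qed
  ultimately show ?thesis using bounded_subset compact_imp_bounded by blast
qed

section \<open>The damping coefficients and their diagonal matrices\<close>

text \<open>The second branch vanishes at \<open>m = 0\<close>, so clipping the normalized distance
  at 0 merges the two cases; continuity and nonnegativity are then read off a single
  expression.\<close>

lemma damping_profile_eq:
  assumes "0 < L"
  shows "damping_profile \<alpha> L \<xi>bar s =
    (let m = max 0 (\<bar>s\<bar> - \<alpha>) / L in \<xi>bar * (m - sin (2 * pi * m) / (2 * pi)))"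
  using assms by (auto simp: damping_profile_def Let_def max_def)

lemma damping_profile_nonneg:
  assumes "0 < L" "0 \<le> \<xi>bar"
  shows "0 \<le> damping_profile \<alpha> L \<xi>bar s"
proof -
  have "0 \<le> m - sin (2 * pi * m) / (2 * pi)" if "0 \<le> m" for m :: real
    using sin_x_le_x[of "2 * pi * m"] that by (simp add: field_simps)
  from this[of "max 0 (\<bar>s\<bar> - \<alpha>) / L"] show ?thesis
    using assms by (simp add: damping_profile_eq Let_def)
qed

lemma continuous_damping_profile:
  assumes "0 < L"
  shows "continuous_on S (damping_profile \<alpha> L \<xi>bar)"
  unfolding damping_profile_eq[OF assms, abs_def] Let_def using assms
  by (intro continuous_intros) auto

lemma matrix_vector_mult_diag: "(diag v *v w) $ i = v $ i * w $ i"
  by (simp add: diag_def matrix_vector_mult_def if_distrib[of "\<lambda>x. x * _"] cong: if_cong)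

lemma diag_add: "diag v + diag w = diag (v + w)"
  by (simp add: diag_def vec_eq_iff)

lemma scaleR_diag: "r *\<^sub>R diag v = diag (r *\<^sub>R v)"
  by (simp add: diag_def vec_eq_iff)

lemma diag_mult: "diag v ** diag w = diag (\<chi> i. v $ i * w $ i)"
  by (auto simp: diag_def matrix_matrix_mult_def vec_eq_iff if_distrib[of "\<lambda>x. x * _"] cong: if_cong)

lemma coeff_a_eq: "coeff_a \<xi> x = \<xi> x $ 1 + \<xi> x $ 2"
  by (simp add: coeff_a_def Gamma1_def diag_def trace_def sum_2)

lemma coeff_b_eq: "coeff_b \<xi> x = \<xi> x $ 1 * \<xi> x $ 2"
  by (simp add: coeff_b_def Gamma1_def diag_def det_2)

section \<open>The pointwise energy identity\<close>

text \<open>The left side is the rate of the energy density after the equations are inserted: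
  \<open>g1\<close>, \<open>g2\<close> stand for the gradient of \<open>q\<close>,
  \<open>d1\<close>, \<open>d2\<close> for the two terms of the divergence of \<open>chi\<close>,
  and \<open>X1\<close>, \<open>X2\<close>, \<open>l1\<close>, \<open>l2\<close> for the components
  of \<open>chi\<close> and \<open>lam\<close>. The right side is \<open>c\<close> times the
  divergence of \<open>q\<close> times \<open>chi\<close>, minus the dissipation density.\<close>

lemma energy_density_rate:
  fixes a b x1 x2 p q c g1 g2 d1 d2 X1 X2 l1 l2 :: real
  assumes "0 \<le> x1" "0 \<le> x2"
  defines "a \<equiv> x1 + x2" and "b \<equiv> x1 * x2"
  shows "q * (- b * p + c * (d1 + d2))
      + (X1 * (c * g1 - 2 * (x1 * X1) + x1 * l1) + X2 * (c * g2 - 2 * (x2 * X2) + x2 * l2))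
      + b * p * (q - a * p)
      + (inverse a * x1 * l1 * (- (x2 * l1) + (x2 - x1) * X1)
       + inverse a * x2 * l2 * (- (x1 * l2) + (x1 - x2) * X2))
    = c * ((q * d1 + g1 * X1) + (q * d2 + g2 * X2))
      - (a * b * p\<^sup>2 + ((x1 + inverse a * x1\<^sup>2) * X1\<^sup>2 + (x2 + inverse a * x2\<^sup>2) * X2\<^sup>2)
         + inverse a * b * ((X1 - l1)\<^sup>2 + (X2 - l2)\<^sup>2))"
proof -
  \<comment> \<open>Since both values are nonnegative, \<open>a = 0\<close> forces both to vanish,
    so the default \<open>inverse 0 = 0\<close> does no harm.\<close>
  have "inverse a * (x1 + x2) = 1 \<or> x1 = 0 \<and> x2 = 0"
    using assms(1,2) by (cases "a = 0") (auto simp: a_def)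
  then have "(x1 * X1\<^sup>2 - x1 * l1 * X1 + x2 * X2\<^sup>2 - x2 * l2 * X2) * (inverse a * (x1 + x2) - 1) = 0"
    by auto
  \<comment> \<open>With a free \<open>k\<close> in place of \<open>inverse a\<close> the claim is a
    polynomial identity up to a multiple of \<open>k * (x1 + x2) - 1\<close>; for
    \<open>k = inverse a\<close> that extra product is 0 by the preceding fact.\<close>
  moreover have "q * (- (x1 * x2) * p + c * (d1 + d2))
      + (X1 * (c * g1 - 2 * (x1 * X1) + x1 * l1) + X2 * (c * g2 - 2 * (x2 * X2) + x2 * l2))
      + x1 * x2 * p * (q - (x1 + x2) * p)
      + (k * x1 * l1 * (- (x2 * l1) + (x2 - x1) * X1)
       + k * x2 * l2 * (- (x1 * l2) + (x1 - x2) * X2))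
    = c * ((q * d1 + g1 * X1) + (q * d2 + g2 * X2))
      - ((x1 + x2) * (x1 * x2) * p\<^sup>2 + ((x1 + k * x1\<^sup>2) * X1\<^sup>2 + (x2 + k * x2\<^sup>2) * X2\<^sup>2)
         + k * (x1 * x2) * ((X1 - l1)\<^sup>2 + (X2 - l2)\<^sup>2))
      + (x1 * X1\<^sup>2 - x1 * l1 * X1 + x2 * X2\<^sup>2 - x2 * l2 * X2) * (k * (x1 + x2) - 1)" for k
    by algebra
  ultimately show ?thesis
    unfolding b_def a_def by simp
qed

section \<open>Bounds, inner products and the integral of the divergence\<close>

lemma bounded_mult_comp:
  fixes f g :: "'a \<Rightarrow> 'b::real_normed_algebra"
  assumes "bounded (f ` S)" "bounded (g ` S)"
  shows "bounded ((\<lambda>x. f x * g x) ` S)"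
proof -
  obtain A B where "\<And>x. x \<in> S \<Longrightarrow> norm (f x) \<le> A" "\<And>x. x \<in> S \<Longrightarrow> norm (g x) \<le> B"
    using assms unfolding bounded_iff by blast
  then have "norm (f x * g x) \<le> A * B" if "x \<in> S" for x
    using that by (intro order_trans[OF norm_mult_ineq] mult_mono') auto
  then show ?thesis by (auto simp: bounded_iff)
qed

lemma bounded_vec_nth_comp: "bounded (f ` S) \<Longrightarrow> bounded ((\<lambda>x. f x $ i) ` S)"
  using bounded_component_cart[of "f ` S" i] by (simp add: image_image)

lemma bounded_slice:
  assumes "bounded ((\<lambda>z. f (fst z) (snd z)) ` ({t} \<times> G))"
  shows "bounded (f t ` G)"
  by (rule bounded_subset[OF assms]) force

lemma L2_inner_eq:
  assumes "open G"
  shows "L2_inner G u v = integral\<^sup>L (restrict_space lborel G) (\<lambda>x. u x \<bullet> v x)"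
  using assms by (simp add: L2_inner_def set_lebesgue_integral_def integral_restrict_space)

lemma L2_norm_power2: "(L2_norm G u)\<^sup>2 = L2_inner G u u"
  unfolding L2_norm_def L2_inner_def set_lebesgue_integral_def
  by (intro real_sqrt_pow2 Bochner_Integration.integral_nonneg) (auto simp: indicator_def)

text \<open>The weights \<open>b\<close>, \<open>k1\<close>, \<open>k2\<close> are constant in time,
  and the derivative is arranged in the shape of the left side of
  \<open>energy_density_rate\<close>.\<close>

lemma energy_density_derivative:
  fixes p q X1 X2 l1 l2 :: "real \<Rightarrow> real"
  assumes "(p has_real_derivative p') (at t within S)" "(q has_real_derivative q') (at t within S)"
    and "(X1 has_real_derivative X1') (at t within S)" "(X2 has_real_derivative X2') (at t within S)"
    and "(l1 has_real_derivative l1') (at t within S)" "(l2 has_real_derivative l2') (at t within S)"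
  shows "((\<lambda>s. 1/2 * ((q s)\<^sup>2 + ((X1 s)\<^sup>2 + (X2 s)\<^sup>2) + b * (p s)\<^sup>2
        + (k1 * (l1 s)\<^sup>2 + k2 * (l2 s)\<^sup>2)))
    has_real_derivative
      q t * q' + (X1 t * X1' + X2 t * X2') + b * p t * p' + (k1 * l1 t * l1' + k2 * l2 t * l2'))
    (at t within S)"
  by (rule derivative_eq_intros assms refl)+ (simp add: algebra_simps)

text \<open>By the product rule \<open>W t\<close> is the partial derivative in direction
  \<open>i\<close> of \<open>q\<close> times component \<open>i\<close> of \<open>v\<close>, and
  this product inherits its zero boundary values from \<open>q\<close>. Summed over
  \<open>i\<close>, it is the divergence of \<open>q\<close> times \<open>v\<close>.\<close>

lemma integral_divergence_zero:
  fixes q :: "real \<Rightarrow> real^2 \<Rightarrow> real" and v :: "real \<Rightarrow> real^2 \<Rightarrow> real^2" and i :: 2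
  assumes G: "open G" "bounded G" and t: "t \<in> I"
    and q: "C1_up_to_boundary I G q" and v: "C1_up_to_boundary I G v"
    and zero: "\<And>x. x \<in> frontier G \<Longrightarrow> q t x = 0"
  defines "W \<equiv> \<lambda>t x. q t x * frechet_derivative (v t) (at x) (axis i 1) $ i
      + frechet_derivative (q t) (at x) (axis i 1) * v t x $ i"
  shows "W t \<in> borel_measurable (restrict_space lborel G)"
    and "\<And>J. compact J \<Longrightarrow> J \<subseteq> I \<Longrightarrow> bounded ((\<lambda>z. W (fst z) (snd z)) ` (J \<times> G))"
    and "integral\<^sup>L (restrict_space lborel G) (W t) = 0"
proof -
  have sub: "continuous_on (closure G) f \<Longrightarrow> continuous_on G f" for f :: "real^2 \<Rightarrow> 'b::topological_space"
    using closure_subset continuous_on_subset by blast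
  note cont = C1_up_to_boundary_continuous_slice[OF q t] C1_up_to_boundary_continuous_slice[OF v t]
  show m: "W t \<in> borel_measurable (restrict_space lborel G)"
    unfolding W_def using cont[THEN sub]
      C1_up_to_boundary_derivative_continuous[OF q G(1) t, of "axis i 1"]
      C1_up_to_boundary_derivative_continuous[OF v G(1) t, of "axis i 1"]
    by (auto intro!: measurable_continuous_on_restrict_lborel continuous_intros)
  show b: "bounded ((\<lambda>z. W (fst z) (snd z)) ` (J \<times> G))" if "compact J" "J \<subseteq> I" for J
  proof -
    note bq = C1_up_to_boundary_bounded[OF q G(2) that]
    note bv = C1_up_to_boundary_bounded[OF v G(2) that, THEN bounded_vec_nth_comp, of i]
    note bdq = C1_up_to_boundary_derivative_bounded[OF q G that, of "axis i 1"]
    note bdv = C1_up_to_boundary_derivative_bounded[OF v G that, of "axis i 1", THEN bounded_vec_nth_comp, of i]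
    show ?thesis
      unfolding W_def by (rule bounded_plus_comp[OF bounded_mult_comp[OF bq bdv] bounded_mult_comp[OF bdq bv]])
  qed
  have "bounded (W t ` G)" using t by (intro bounded_slice[of W t G] b) auto
  then obtain B where B: "\<And>x. x \<in> G \<Longrightarrow> \<bar>W t x\<bar> \<le> B" by (auto simp: bounded_iff)
  show "integral\<^sup>L (restrict_space lborel G) (W t) = 0"
  proof -
    \<comment> \<open>Leaving the direction \<open>h\<close> free makes \<open>D x\<close> the full
      derivative of the product, as \<open>integral_partial_derivative_zero\<close> expects.\<close>
    define D where "D x h = q t x * frechet_derivative (v t) (at x) h $ i
      + frechet_derivative (q t) (at x) h * v t x $ i" for x h
    have WD: "W t = (\<lambda>x. D x (axis i 1))" by (simp add: W_def D_def fun_eq_iff)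
    show ?thesis
      unfolding WD
    proof (rule integral_partial_derivative_zero[OF G, of "\<lambda>x. q t x * v t x $ i" D i B])
      show "continuous_on (closure G) (\<lambda>x. q t x * v t x $ i)"
        using cont by (intro continuous_intros)
      show "((\<lambda>x. q t x * v t x $ i) has_derivative D x) (at x)" if x: "x \<in> G" for x
        unfolding D_def[abs_def]
        using C1_up_to_boundary_differentiable[OF q G(1) t x]
          bounded_linear.has_derivative[OF bounded_linear_vec_nth C1_up_to_boundary_differentiable[OF v G(1) t x], of i]
        by (rule has_derivative_mult)
    qed (use m B zero WD in auto)
  qed
qed

theorem theorem2p1:
  fixes \<alpha> L \<xi>bar :: "real^2"
    and \<xi> :: "real^2 \<Rightarrow> real^2"
    and \<Omega> D G :: "(real^2) set"
    and c T :: real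
    and p q :: "real \<Rightarrow> real^2 \<Rightarrow> real"
    and chi lam :: "real \<Rightarrow> real^2 \<Rightarrow> real^2"
  assumes "\<And>i. 0 < \<alpha> $ i" and "\<And>i. 0 < L $ i" and "\<And>i. 0 \<le> \<xi>bar $ i"
    and "\<xi> = (\<lambda>x. \<chi> i. damping_profile (\<alpha> $ i) (L $ i) (\<xi>bar $ i) (x $ i))"
    and "\<Omega> = box (- \<alpha> - L) (\<alpha> + L)"
    and "smooth_open_set D" and "bounded D" and "closure D \<subseteq> box (- \<alpha>) \<alpha>"
    and "G = \<Omega> - closure D"
    and "0 < c" and "0 < T"
    and "C1_up_to_boundary {0<..T} G p" and "C1_up_to_boundary {0<..T} G q"
    and "C1_up_to_boundary {0<..T} G chi" and "C1_up_to_boundary {0<..T} G lam"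
    and p_eq: "\<And>t x. t \<in> {0<..T} \<Longrightarrow> x \<in> G \<Longrightarrow>
      ((\<lambda>s. p s x) has_vector_derivative q t x - coeff_a \<xi> x * p t x) (at t within {0<..T})"
    and q_eq: "\<And>t x. t \<in> {0<..T} \<Longrightarrow> x \<in> G \<Longrightarrow>
      ((\<lambda>s. q s x) has_vector_derivative - coeff_b \<xi> x * p t x + c * divergence (chi t) x)
        (at t within {0<..T})"
    and chi_eq: "\<And>t x. t \<in> {0<..T} \<Longrightarrow> x \<in> G \<Longrightarrow>
      ((\<lambda>s. chi s x) has_vector_derivative
        c *\<^sub>R gradient (q t) x - 2 *\<^sub>R (Gamma1 \<xi> x *v chi t x) + Gamma1 \<xi> x *v lam t x)
        (at t within {0<..T})"
    and lam_eq: "\<And>t x. t \<in> {0<..T} \<Longrightarrow> x \<in> G \<Longrightarrow>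
      ((\<lambda>s. lam s x) has_vector_derivative
        - (Gamma1_tilde \<xi> x *v lam t x) + Gamma2 \<xi> x *v chi t x)
        (at t within {0<..T})"
    and p_bc_D: "\<And>t x. t \<in> {0<..T} \<Longrightarrow> x \<in> frontier D \<Longrightarrow> p t x = 0"
    and p_bc_Omega: "\<And>t x. t \<in> {0<..T} \<Longrightarrow> x \<in> frontier \<Omega> \<Longrightarrow> p t x = 0"
    and lam_bc: "\<And>t x n. t \<in> {0<..T} \<Longrightarrow> x \<in> frontier \<Omega> \<Longrightarrow> rectangle_normal (\<alpha> + L) x n \<Longrightarrow>
      lam t x \<bullet> n = 0"
  shows "\<forall>t \<in> {0<..T}.
      (energy \<xi> G p q chi lam has_real_derivative - dissipation \<xi> G p chi lam t)
        (at t within {0<..T}) \<and>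
      0 \<le> dissipation \<xi> G p chi lam t"
proof (intro ballI)
  fix t assume t: "t \<in> {0<..T}"
  let ?I = "{0<..T}"

  \<comment> \<open>The domain, its frontier and the boundary values of \<open>p\<close> and
    \<open>q\<close>\<close>
  define M where "M = restrict_space lborel G"
  note \<xi>_eq = assms(4)
  have xn: "0 \<le> \<xi> x $ i" for x i
    using assms(2,3) by (simp add: \<xi>_eq damping_profile_nonneg)
  have xc: "continuous_on S (\<lambda>x. \<xi> x $ i)" for S i
    unfolding \<xi>_eq using assms(2)
    by (auto intro!: continuous_on_compose2[OF continuous_damping_profile[of _ UNIV]] continuous_intros)
  have G: "open G" "bounded G"
    using assms(5,9) bounded_subset[OF bounded_box] by (auto simp: open_Diff)
  have space_M: "space M = G" by (simp add: M_def space_restrict_space)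
  have fr: "x \<in> frontier \<Omega> \<or> x \<in> frontier D" if "x \<in> frontier G" for x
  proof -
    have "frontier G \<subseteq> frontier \<Omega> \<union> frontier (- closure D)"
      using frontier_Int_subset[of \<Omega> "- closure D"] assms(9) by (simp add: Diff_eq)
    \<comment> \<open>\<open>- closure D\<close> has the frontier of \<open>closure D\<close>, which
      lies in that of \<open>D\<close> because \<open>interior D\<close> is contained in the
      interior of \<open>closure D\<close>.\<close>
    moreover have "frontier (- closure D) \<subseteq> frontier D"
      unfolding frontier_complement using interior_mono[OF closure_subset[of D]]
      by (auto simp: frontier_def)
    ultimately show ?thesis using that by blast
  qed
  have pz: "p s x = 0" if "s \<in> ?I" "x \<in> frontier G" for s x
    using fr[OF that(2)] p_bc_D[OF that(1)] p_bc_Omega[OF that(1)] by blast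
  have qz: "q s x = 0" if s: "s \<in> ?I" and x: "x \<in> frontier G" for s x
  proof -
    have xG: "x \<in> closure G" using x by (simp add: frontier_def)
    \<comment> \<open>The boundary value of \<open>q\<close> comes from \<open>p\<close>: where
      \<open>p\<close> vanishes at all times, so does the extension of its time derivative
      \<open>q - a p\<close>, and then \<open>q = a p = 0\<close>.\<close>
    have "q s x - (\<xi> x $ 1 + \<xi> x $ 2) * p s x = 0"
    proof (rule time_derivative_zero_on_frontier[OF _ _ _ xG _ s,
          of p "\<lambda>s x. q s x - (\<xi> x $ 1 + \<xi> x $ 2) * p s x"])
      show "continuous_on (?I \<times> closure G) (\<lambda>(s, x). q s x - (\<xi> x $ 1 + \<xi> x $ 2) * p s x)"
        using C1_up_to_boundary_continuous[OF assms(12)] C1_up_to_boundary_continuous[OF assms(13)]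
        unfolding case_prod_beta
        by (intro continuous_intros continuous_on_compose2[OF xc[of UNIV]]) auto
    qed (use C1_up_to_boundary_continuous[OF assms(12)] p_eq pz x in \<open>auto simp: coeff_a_eq\<close>)
    then show ?thesis using pz[OF s x] by simp
  qed

  \<comment> \<open>Densities of the energy, the dissipation and the divergence\<close>
  define \<kappa> where "\<kappa> i x = inverse (\<xi> x $ 1 + \<xi> x $ 2) * \<xi> x $ i" for i x
  have kn: "0 \<le> \<kappa> i x" for i x unfolding \<kappa>_def using xn[of x] by simp
  \<comment> \<open>\<open>inverse a\<close> may be unbounded near the zero set of \<open>a\<close>,
    but in the densities it enters only through \<open>\<kappa>\<close>, which lies between 0 and 1.
    As \<open>\<kappa>\<close> may jump at the edge of that set, it is treated as a bounded
    measurable weight.\<close>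
  have k1: "\<kappa> i x \<le> 1" for i x
  proof -
    have "\<xi> x $ i \<le> \<xi> x $ 1 + \<xi> x $ 2"
      using xn[of x 1] xn[of x 2] exhaust_2[of i] by auto
    then show ?thesis
      using xn[of x i] unfolding \<kappa>_def
      by (cases "\<xi> x $ 1 + \<xi> x $ 2 = 0") (auto simp: field_simps)
  qed
  define W where "W i s x = q s x * frechet_derivative (chi s) (at x) (axis i 1) $ i
      + frechet_derivative (q s) (at x) (axis i 1) * chi s x $ i" for i s x
  define e where "e s x = 1/2 * ((q s x)\<^sup>2 + ((chi s x $ 1)\<^sup>2 + (chi s x $ 2)\<^sup>2)
      + \<xi> x $ 1 * \<xi> x $ 2 * (p s x)\<^sup>2
      + (\<kappa> 1 x * (lam s x $ 1)\<^sup>2 + \<kappa> 2 x * (lam s x $ 2)\<^sup>2))" for s x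
  define d1 where "d1 s x = (\<xi> x $ 1 + \<xi> x $ 2) * (\<xi> x $ 1 * \<xi> x $ 2) * (p s x)\<^sup>2" for s x
  define d2 where "d2 s x = (\<xi> x $ 1 + \<kappa> 1 x * \<xi> x $ 1) * (chi s x $ 1)\<^sup>2
      + (\<xi> x $ 2 + \<kappa> 2 x * \<xi> x $ 2) * (chi s x $ 2)\<^sup>2" for s x
  \<comment> \<open>The weight \<open>\<kappa> 1 x * \<xi> x $ 2\<close> is \<open>b / a\<close>; in
    \<open>d2\<close> the products \<open>\<kappa> i x * \<xi> x $ i\<close> are the diagonal
    entries of \<open>Gamma1\<close> squared over \<open>a\<close>.\<close>
  define d3 where "d3 s x = \<kappa> 1 x * \<xi> x $ 2
      * ((chi s x $ 1 - lam s x $ 1)\<^sup>2 + (chi s x $ 2 - lam s x $ 2)\<^sup>2)" for s x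
  note dens_defs = e_def d1_def d2_def d3_def

  \<comment> \<open>Measurability, uniform bounds and integrability of the densities\<close>
  note C1 = assms(12-15)
  have cG: "continuous_on (closure G) f \<Longrightarrow> f \<in> borel_measurable M" for f :: "real^2 \<Rightarrow> real"
    unfolding M_def
    by (rule measurable_continuous_on_restrict_lborel[OF continuous_on_subset[OF _ closure_subset]])
  have mx [measurable]: "(\<lambda>x. \<xi> x $ i) \<in> borel_measurable M" for i by (rule cG[OF xc])
  have mk [measurable]: "\<kappa> i \<in> borel_measurable M" for i unfolding \<kappa>_def[abs_def] by measurable
  have ms: "p s \<in> borel_measurable M" "q s \<in> borel_measurable M"
      "(\<lambda>x. chi s x $ i) \<in> borel_measurable M" "(\<lambda>x. lam s x $ i) \<in> borel_measurable M"
    if "s \<in> ?I" for s i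
    using C1[THEN C1_up_to_boundary_continuous_slice[OF _ that]]
    by (auto intro!: cG continuous_intros)
  have md: "d1 s \<in> borel_measurable M" "d2 s \<in> borel_measurable M" "d3 s \<in> borel_measurable M"
      "e s \<in> borel_measurable M" if "s \<in> ?I" for s
    unfolding dens_defs[abs_def] using ms[OF that, measurable] by measurable

  have bx: "bounded ((\<lambda>z. \<xi> (snd z) $ i) ` (J \<times> G))" for i and J :: "real set"
  proof -
    have "bounded ((\<lambda>x. \<xi> x $ i) ` closure G)"
      using xc G(2) by (intro compact_imp_bounded compact_continuous_image) (auto simp: compact_closure)
    then show ?thesis by (rule bounded_subset) (use closure_subset in force)
  qed
  have bk: "bounded ((\<lambda>z. \<kappa> i (snd z)) ` (J \<times> G))" for i and J :: "real set"
    using kn k1 by (auto simp: bounded_iff intro!: exI[of _ 1])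
  have bd: "bounded ((\<lambda>z. d1 (fst z) (snd z)) ` (J \<times> G))" "bounded ((\<lambda>z. d2 (fst z) (snd z)) ` (J \<times> G))"
      "bounded ((\<lambda>z. d3 (fst z) (snd z)) ` (J \<times> G))"
      "bounded ((\<lambda>z. (q (fst z) (snd z))\<^sup>2) ` (J \<times> G))"
      "bounded ((\<lambda>z. (chi (fst z) (snd z) $ 1)\<^sup>2 + (chi (fst z) (snd z) $ 2)\<^sup>2) ` (J \<times> G))"
      "bounded ((\<lambda>z. \<xi> (snd z) $ 1 * \<xi> (snd z) $ 2 * (p (fst z) (snd z))\<^sup>2) ` (J \<times> G))"
      "bounded ((\<lambda>z. \<kappa> 1 (snd z) * (lam (fst z) (snd z) $ 1)\<^sup>2
        + \<kappa> 2 (snd z) * (lam (fst z) (snd z) $ 2)\<^sup>2) ` (J \<times> G))"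
    if "compact J" "J \<subseteq> ?I" for J
    unfolding dens_defs power2_eq_square
    by (intro bounded_plus_comp bounded_minus_comp bounded_mult_comp bounded_vec_nth_comp bx bk
        C1[THEN C1_up_to_boundary_bounded[OF _ G(2) that]])+
  note div = integral_divergence_zero[OF G _ assms(13,14) qz, folded W_def M_def]

  \<comment> \<open>The bound is applied with \<open>J = {s}\<close>; the premise ranges over
    compact \<open>J\<close> so that the bounds above fit as they stand.\<close>
  have intI: "integrable M (f s)"
    if "s \<in> ?I" "f s \<in> borel_measurable M"
      "\<And>J. compact J \<Longrightarrow> J \<subseteq> ?I \<Longrightarrow> bounded ((\<lambda>z. f (fst z) (snd z)) ` (J \<times> G))"
    for f :: "real \<Rightarrow> real^2 \<Rightarrow> real" and s
    unfolding M_def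
    by (rule integrable_restrict_lborel_bounded[OF G that(2)[unfolded M_def] bounded_slice[of f s G]])
       (use that(1,3) in auto)
  have int_d: "integrable M (d1 s)" "integrable M (d2 s)" "integrable M (d3 s)" if "s \<in> ?I" for s
    using that md bd by (auto intro!: intI)
  have int_W: "integrable M (W i s)" if "s \<in> ?I" for i s
    using that div by (auto intro!: intI)
  have int_q: "integrable M (\<lambda>x. (q s x)\<^sup>2)"
    and int_chi: "integrable M (\<lambda>x. (chi s x $ 1)\<^sup>2 + (chi s x $ 2)\<^sup>2)"
    and int_p: "integrable M (\<lambda>x. \<xi> x $ 1 * \<xi> x $ 2 * (p s x)\<^sup>2)"
    and int_lam: "integrable M (\<lambda>x. \<kappa> 1 x * (lam s x $ 1)\<^sup>2 + \<kappa> 2 x * (lam s x $ 2)\<^sup>2)"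
    if s: "s \<in> ?I" for s
  proof -
    note ms[OF s, measurable]
    show "integrable M (\<lambda>x. (q s x)\<^sup>2)"
      by (rule intI[OF s, of "\<lambda>s x. (q s x)\<^sup>2"]) (measurable, rule bd)
    show "integrable M (\<lambda>x. (chi s x $ 1)\<^sup>2 + (chi s x $ 2)\<^sup>2)"
      by (rule intI[OF s, of "\<lambda>s x. (chi s x $ 1)\<^sup>2 + (chi s x $ 2)\<^sup>2"]) (measurable, rule bd)
    show "integrable M (\<lambda>x. \<xi> x $ 1 * \<xi> x $ 2 * (p s x)\<^sup>2)"
      by (rule intI[OF s, of "\<lambda>s x. \<xi> x $ 1 * \<xi> x $ 2 * (p s x)\<^sup>2"]) (measurable, rule bd)
    show "integrable M (\<lambda>x. \<kappa> 1 x * (lam s x $ 1)\<^sup>2 + \<kappa> 2 x * (lam s x $ 2)\<^sup>2)"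
      by (rule intI[OF s, of "\<lambda>s x. \<kappa> 1 x * (lam s x $ 1)\<^sup>2 + \<kappa> 2 x * (lam s x $ 2)\<^sup>2"]) (measurable, rule bd)
  qed
  note int_e_parts = int_q int_chi int_p int_lam
  have int_e: "integrable M (e s)" if "s \<in> ?I" for s
    unfolding e_def[abs_def] using int_e_parts[OF that] by simp

  \<comment> \<open>Energy and dissipation as integrals of their densities\<close>
  note L2_M = L2_inner_eq[OF G(1), folded M_def]
  have energy_eq: "energy \<xi> G p q chi lam s = integral\<^sup>L M (e s)" if s: "s \<in> ?I" for s
    unfolding energy_def L2_norm_power2 wnorm2_def mnorm2_def L2_M e_def[abs_def]
    using int_e_parts[OF s]
    by (simp add: coeff_a_eq coeff_b_eq Gamma1_def scaleR_diag matrix_vector_mult_diag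
        inner_vec_def sum_2 \<kappa>_def power2_eq_square mult.assoc)
  have diss_eq: "dissipation \<xi> G p chi lam s = integral\<^sup>L M (\<lambda>x. d1 s x + d2 s x + d3 s x)"
    if s: "s \<in> ?I" for s
  proof -
    have "integral\<^sup>L M (\<lambda>x. d1 s x + d2 s x + d3 s x)
        = integral\<^sup>L M (d1 s) + integral\<^sup>L M (d2 s) + integral\<^sup>L M (d3 s)"
      using int_d[OF s] by simp
    then show ?thesis
      unfolding dissipation_def wnorm2_def mnorm2_def L2_M dens_defs[abs_def]
      by (simp add: coeff_a_eq coeff_b_eq Gamma1_def diag_mult diag_add scaleR_diag
          matrix_vector_mult_diag inner_vec_def sum_2 \<kappa>_def power2_eq_square mult.assoc distrib_left)
  qed

  \<comment> \<open>Nonnegativity of the dissipation and the energy law\<close>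
  have "0 \<le> dissipation \<xi> G p chi lam t"
    unfolding diss_eq[OF t]
    by (rule Bochner_Integration.integral_nonneg) (simp add: dens_defs xn kn)
  moreover have "(energy \<xi> G p q chi lam has_real_derivative - dissipation \<xi> G p chi lam t)
        (at t within ?I)"
  proof -
    \<comment> \<open>\<open>J\<close> is compact in \<open>{0<..T}\<close>, so the bounds are
      uniform on it, and it contains all times of \<open>{0<..T}\<close> near \<open>t\<close>. Its
      right end is \<open>T\<close>, so \<open>t = T\<close> is treated like any other time.\<close>
    define J where "J = {t/2..T}"
    have J: "compact J" "J \<subseteq> ?I" "convex J" "t \<in> J" using t by (auto simp: J_def)
    define e' where "e' s x = c * (W 1 s x + W 2 s x) - (d1 s x + d2 s x + d3 s x)" for s x
    have "bounded ((\<lambda>z. e' (fst z) (snd z)) ` (J \<times> G))"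
      unfolding e'_def
      by (intro bounded_plus_comp bounded_minus_comp bounded_mult_comp bd J div(2)[OF t])
         (use t in \<open>auto simp: image_constant_conv\<close>)
    then obtain B where B: "\<And>s x. s \<in> J \<Longrightarrow> x \<in> G \<Longrightarrow> \<bar>e' s x\<bar> \<le> B"
      by (force simp: bounded_iff)
    have der: "((\<lambda>s. e s x) has_real_derivative e' s x) (at s within J)"
      if s: "s \<in> J" and x: "x \<in> G" for s x
    proof -
      have sI: "s \<in> ?I" using s J by blast
      note sub = has_vector_derivative_within_subset[OF _ J(2)]
      note vec = bounded_linear.has_vector_derivative[OF bounded_linear_vec_nth]
      note simps = has_real_derivative_iff_has_vector_derivative coeff_a_eq coeff_b_eq Gamma1_def
        Gamma2_def Gamma1_tilde_def diag_add matrix_vector_mult_diag gradient_def divergence_def sum_2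
      have 1: "((\<lambda>s. p s x) has_real_derivative q s x - (\<xi> x $ 1 + \<xi> x $ 2) * p s x) (at s within J)"
        using sub[OF p_eq[OF sI x]] by (simp add: simps)
      have 2: "((\<lambda>s. q s x) has_real_derivative - (\<xi> x $ 1 * \<xi> x $ 2) * p s x
          + c * (frechet_derivative (chi s) (at x) (axis 1 1) $ 1
             + frechet_derivative (chi s) (at x) (axis 2 1) $ 2)) (at s within J)"
        using sub[OF q_eq[OF sI x]] by (simp add: simps)
      have 3: "((\<lambda>s. chi s x $ i) has_real_derivative c * frechet_derivative (q s) (at x) (axis i 1)
          - 2 * (\<xi> x $ i * chi s x $ i) + \<xi> x $ i * lam s x $ i) (at s within J)" for i
        using vec[OF sub[OF chi_eq[OF sI x]], of i] by (simp add: simps)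
      have 4: "((\<lambda>s. lam s x $ 1) has_real_derivative - (\<xi> x $ 2 * lam s x $ 1)
          + (\<xi> x $ 2 - \<xi> x $ 1) * chi s x $ 1) (at s within J)"
        using vec[OF sub[OF lam_eq[OF sI x]], of 1] by (simp add: simps)
      have 5: "((\<lambda>s. lam s x $ 2) has_real_derivative - (\<xi> x $ 1 * lam s x $ 2)
          + (\<xi> x $ 1 - \<xi> x $ 2) * chi s x $ 2) (at s within J)"
        using vec[OF sub[OF lam_eq[OF sI x]], of 2] by (simp add: simps)
      \<comment> \<open>The chain rule yields the derivative in raw form;
        \<open>energy_density_rate\<close>, with nonnegative damping, converts it into
        \<open>e'\<close>.\<close>
      show ?thesis
        unfolding e_def
        by (rule DERIV_cong[OF energy_density_derivative[OF 1 2 3 3 4 5]],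
            unfold e'_def W_def dens_defs \<kappa>_def, subst energy_density_rate[OF xn xn])
           (simp add: power2_eq_square mult.assoc)
    qed
    have "((\<lambda>s. integral\<^sup>L M (e s)) has_real_derivative integral\<^sup>L M (e' t)) (at t within J)"
    proof (rule has_real_derivative_integral_dominated[OF J(3,4), where g = "\<lambda>_. B"])
      show "integrable M (e s)" if "s \<in> J" for s using int_e that J(2) by blast
      show "e' t \<in> borel_measurable M"
        unfolding e'_def[abs_def]
        using int_d[OF t, THEN borel_measurable_integrable] int_W[OF t, THEN borel_measurable_integrable]
        by (intro borel_measurable_diff borel_measurable_add borel_measurable_times) auto
      show "integrable M (\<lambda>_. B)"
        unfolding M_def
        by (rule integrable_restrict_lborel_bounded[OF G]) (auto simp: image_constant_conv)
    qed (use der B in \<open>simp_all add: space_M\<close>)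
    \<comment> \<open>The divergence terms integrate to 0 since \<open>q\<close> vanishes on the
      frontier, which leaves the dissipation.\<close>
    also have "integral\<^sup>L M (e' t) = - dissipation \<xi> G p chi lam t"
      unfolding e'_def diss_eq[OF t] using int_d[OF t] int_W[OF t] div(3)[OF t] t
      by simp
    \<comment> \<open>Both time sets coincide on the neighbourhood \<open>{t/2<..}\<close> of
      \<open>t\<close>.\<close>
    also have "at t within J = at t within ?I"
      by (rule at_within_nhd[of t "{t/2<..}"]) (use t in \<open>auto simp: J_def\<close>)
    finally have "((\<lambda>s. integral\<^sup>L M (e s)) has_real_derivative - dissipation \<xi> G p chi lam t)
        (at t within ?I)" .
    then show ?thesis
      by (rule has_field_derivative_transform_within[OF _ zero_less_one t]) (simp add: energy_eq)
  qed
  ultimately show "(energy \<xi> G p q chi lam has_real_derivative - dissipation \<xi> G p chi lam t)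
        (at t within {0<..T}) \<and> 0 \<le> dissipation \<xi> G p chi lam t" by blast
qed

end
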